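(* Let $d\in\mathbb{N}$ and $a_0,\dots,a_d\in\mathbb{R}$. Consider the polynomial $g:\mathbb{R}\to\mathbb{R}$, $g(x)=a_0+a_1x+\dots+a_dx^d$. Let $\mathfrak{L}:\mathbb{R}\to\mathbb{R}^2$, $\mathfrak{L}(x)=(0,x)$, let $\mathfrak{R}:\mathbb{R}^2\to\mathbb{R}$, $\mathfrak{R}(x,y)=x$, and let $f_1,\dots,f_{d+1}:\mathbb{R}^2\to\mathbb{R}^2$ be $$f_1(x,y)=(a_d,0),\qquad f_k(x,y)=(a_{d-k+1}+x(y-1),0),\quad 2\le k\le d+1 .$$ Then $$\mathfrak{R}\circ(\mathrm{Id}+f_{d+1})\circ\dots\circ(\mathrm{Id}+f_1)\circ\mathfrak{L}=g .$$ In particular, any univariate polynomial (of degree at most $d$) can be represented by a compositional tensor with $d+1$ layers and with the basis $\Phi=\{1,\mathrm{Id}\}$.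
   Context: Given a finite set $\Phi=\{\phi_1,\dots,\phi_n\}$ of functions $\mathbb{R}\to\mathbb{R}$ and linear maps $\mathfrak{L}:\mathbb{R}^{m}\to\mathbb{R}^p$ (lift), $\mathfrak{R}:\mathbb{R}^p\to\mathbb{R}^{d_o}$ (retraction), a function $v:\mathbb{R}^{m}\to\mathbb{R}^{d_o}$ is a compositional tensor with $L$ layers and basis $\Phi$ if $v=\mathfrak{R}\circ(\mathrm{Id}+\psi_L)\circ\dots\circ(\mathrm{Id}+\psi_1)\circ\mathfrak{L}$, where each $\psi_k:\mathbb{R}^p\to\mathbb{R}^p$ has components in the linear span of the products $x\mapsto\phi_{i_1}(x_1)\cdots\phi_{i_p}(x_p)$, $1\le i_1,\dots,i_p\le n$. *)

theory Defs
  imports "HOL-Analysis.Analysis" "HOL-Library.Function_Algebras"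
    "HOL-Computational_Algebra.Polynomial"
begin

text \<open>
  The space \<open>\<real>\<^sup>p\<close> is rendered as \<open>real ^ 'p\<close>, since its coordinates matter. The outer spaces
  \<open>\<real>\<^sup>m\<close> and \<open>\<real>\<^bsup>d_o\<^esup>\<close> only enter through linearity and are arbitrary Euclidean spaces, so that
  \<open>real\<close> itself can serve as \<open>\<real>\<^sup>1\<close>. Addition of functions is pointwise.
\<close>

abbreviation (input) scale_fun :: "real \<Rightarrow> ('a \<Rightarrow> real) \<Rightarrow> 'a \<Rightarrow> real" where
  "scale_fun c f \<equiv> (\<lambda>x. c * f x)"

interpretation real_fun: vector_space "scale_fun :: real \<Rightarrow> ('a \<Rightarrow> real) \<Rightarrow> 'a \<Rightarrow> real"
  by unfold_locales (auto simp: fun_eq_iff algebra_simps)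

definition tensor_products :: "(real \<Rightarrow> real) set \<Rightarrow> (real ^ 'p \<Rightarrow> real) set" where
  "tensor_products \<Phi> = {\<lambda>x. \<Prod>j\<in>UNIV. \<phi> j (x $ j) | \<phi>. \<forall>j. \<phi> j \<in> \<Phi>}"

text \<open>
  \<open>residual_layers \<psi> L\<close> is \<open>(Id + \<psi>\<^sub>L) \<circ> \<dots> \<circ> (Id + \<psi>\<^sub>1)\<close>; indices start at 1, and \<open>\<psi> 0\<close> is never used.
\<close>

primrec residual_layers :: "(nat \<Rightarrow> 'a \<Rightarrow> 'a::ab_group_add) \<Rightarrow> nat \<Rightarrow> 'a \<Rightarrow> 'a" where
  "residual_layers \<psi> 0 = id"
| "residual_layers \<psi> (Suc k) = (id + \<psi> (Suc k)) \<circ> residual_layers \<psi> k"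

definition compositional_tensor ::
    "(real \<Rightarrow> real) set \<Rightarrow> ('m::euclidean_space \<Rightarrow> real ^ 'p) \<Rightarrow> (real ^ 'p \<Rightarrow> 'o::euclidean_space)
      \<Rightarrow> nat \<Rightarrow> ('m \<Rightarrow> 'o) \<Rightarrow> bool" where
  "compositional_tensor \<Phi> lift retr L v \<longleftrightarrow>
     finite \<Phi> \<and> linear lift \<and> linear retr \<and>
     (\<exists>\<psi>. (\<forall>k\<in>{1..L}. \<forall>i. (\<lambda>x. \<psi> k x $ i) \<in> real_fun.span (tensor_products \<Phi>)) \<and>
          v = retr \<circ> residual_layers \<psi> L \<circ> lift)"

end

theory Submission imports Defs begin

text \<open>
  The layers carry out Horner's scheme: on input \<open>(0, x)\<close> the second coordinate keeps \<open>x\<close>, while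
  adding \<open>a\<^sub>j + s (x - 1)\<close> to the first coordinate \<open>s\<close> turns it into \<open>a\<^sub>j + x s\<close>. Each update is a
  linear combination of the products \<open>1\<close>, \<open>x\<close> and \<open>x y\<close> of the basis functions \<open>1\<close> and \<open>Id\<close>.
\<close>

lemma vector_2_eta: "vector [v $ 1, v $ 2] = (v :: 'a::zero ^ 2)"
  by (simp add: vec_eq_iff forall_2)

text \<open>Layer 1 only loads the leading coefficient, so \<open>Suc k\<close> layers amount to
  \<open>k\<close> Horner steps: the first coordinate then holds the polynomial formed from the top
  \<open>k + 1\<close> coefficients. At \<open>k = d\<close> this is the whole polynomial.\<close>

lemma residual_layers_horner:
  fixes a :: "nat \<Rightarrow> real" and f :: "nat \<Rightarrow> real ^ 2 \<Rightarrow> real ^ 2"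
  assumes f_1: "\<And>x y. f 1 (vector [x, y]) = vector [a d, 0]"
    and f_k: "\<And>k x y. 2 \<le> k \<Longrightarrow> k \<le> d + 1 \<Longrightarrow>
                f k (vector [x, y]) = vector [a (d + 1 - k) + x * (y - 1), 0]"
    and "k \<le> d"
  shows "residual_layers f (Suc k) (vector [0, x]) = vector [\<Sum>i\<le>k. a (d - k + i) * x ^ i, x]"
  using \<open>k \<le> d\<close>
proof (induction k)
  case 0
  show ?case
    using f_1[of 0 x] by (simp add: vec_eq_iff forall_2)
next
  case (Suc k)
  have "(\<Sum>i\<le>Suc k. a (d - Suc k + i) * x ^ i)
      = a (d - Suc k) + (\<Sum>i\<le>k. a (d - Suc k + Suc i) * x ^ Suc i)"
    by (simp add: sum.atMost_Suc_shift del: sum.atMost_Suc)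
  \<comment> \<open>Since \<open>Suc k \<le> d\<close>, the subtraction is not truncated and
    \<open>d - Suc k + Suc i = d - k + i\<close>; one factor \<open>x\<close> comes out of each
    term.\<close>
  also have "\<dots> = a (d - Suc k) + x * (\<Sum>i\<le>k. a (d - k + i) * x ^ i)"
    using Suc.prems by (simp add: sum_distrib_left mult_ac Suc_diff_Suc flip: add_Suc)
  finally have horner: "(\<Sum>i\<le>Suc k. a (d - Suc k + i) * x ^ i)
      = a (d - Suc k) + x * (\<Sum>i\<le>k. a (d - k + i) * x ^ i)" .
  let ?s = "\<Sum>i\<le>k. a (d - k + i) * x ^ i"
  have "residual_layers f (Suc (Suc k)) (vector [0, x])
      = vector [?s, x] + f (Suc (Suc k)) (vector [?s, x])"
    using Suc by (simp del: residual_layers.simps add: residual_layers.simps(2)[of f "Suc k"])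
  also have "f (Suc (Suc k)) (vector [?s, x]) = vector [a (d - Suc k) + ?s * (x - 1), 0]"
    using f_k[of "Suc (Suc k)" ?s x] Suc.prems by simp
  finally show ?case
    unfolding horner by (simp add: vec_eq_iff forall_2 algebra_simps)
qed

lemma tensor_products_2I:
  assumes "\<phi> \<in> \<Phi>" "\<theta> \<in> \<Phi>"
  shows "(\<lambda>v :: real ^ 2. \<phi> (v $ 1) * \<theta> (v $ 2)) \<in> tensor_products \<Phi>"
proof -
  let ?h = "\<lambda>j :: 2. if j = 1 then \<phi> else \<theta>"
  have "(\<lambda>v :: real ^ 2. \<phi> (v $ 1) * \<theta> (v $ 2)) = (\<lambda>v. \<Prod>j\<in>UNIV. ?h j (v $ j))"
    by (simp add: UNIV_2)
  moreover have "\<forall>j. ?h j \<in> \<Phi>"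
    using assms by simp
  ultimately show ?thesis
    unfolding tensor_products_def by (intro CollectI exI[of _ ?h] conjI)
qed

text \<open>Expanding gives \<open>b * 1 + c * x y - c * x\<close>, a combination of three tensor
  products. The parameter \<open>c\<close> lets one statement serve both the constant first layer
  (\<open>c = 0\<close>) and the Horner layers (\<open>c = 1\<close>).\<close>

lemma bilinear_in_span_tensor_products:
  fixes b c :: real
  shows "(\<lambda>v :: real ^ 2. b + c * (v $ 1 * (v $ 2 - 1)))
      \<in> real_fun.span (tensor_products {\<lambda>_. 1, id})"
proof -
  have one: "(\<lambda>v :: real ^ 2. 1) \<in> tensor_products {\<lambda>_. 1, id}"
    using tensor_products_2I[of "\<lambda>_. 1" "{\<lambda>_. 1, id}" "\<lambda>_. 1"] by simp
  have x: "(\<lambda>v :: real ^ 2. v $ 1) \<in> tensor_products {\<lambda>_. 1, id}"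
    using tensor_products_2I[of id "{\<lambda>_. 1, id}" "\<lambda>_. 1"] by simp
  have xy: "(\<lambda>v :: real ^ 2. v $ 1 * v $ 2) \<in> tensor_products {\<lambda>_. 1, id}"
    using tensor_products_2I[of id "{\<lambda>_. 1, id}" id] by simp
  have "(\<lambda>v :: real ^ 2. b * 1) + ((\<lambda>v. c * (v $ 1 * v $ 2)) + (\<lambda>v. - c * v $ 1))
      \<in> real_fun.span (tensor_products {\<lambda>_. 1, id})"
    using one x xy by (intro real_fun.span_add real_fun.span_scale real_fun.span_base)
  moreover have "(\<lambda>v :: real ^ 2. b * 1) + ((\<lambda>v. c * (v $ 1 * v $ 2)) + (\<lambda>v. - c * v $ 1))
      = (\<lambda>v. b + c * (v $ 1 * (v $ 2 - 1)))"
    by (simp add: fun_eq_iff algebra_simps)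
  ultimately show ?thesis
    by metis
qed

theorem proposition3p4:
  fixes d :: nat and a :: "nat \<Rightarrow> real" and g :: "real \<Rightarrow> real"
    and lift :: "real \<Rightarrow> real ^ 2" and retr :: "real ^ 2 \<Rightarrow> real"
    and f :: "nat \<Rightarrow> real ^ 2 \<Rightarrow> real ^ 2"
  assumes g: "\<And>x. g x = (\<Sum>i\<le>d. a i * x ^ i)"
    and lift: "\<And>x. lift x = vector [0, x]"
    and retr: "\<And>x y. retr (vector [x, y]) = x"
    and f_1: "\<And>x y. f 1 (vector [x, y]) = vector [a d, 0]"
    and f_k: "\<And>k x y. 2 \<le> k \<Longrightarrow> k \<le> d + 1 \<Longrightarrow>
                f k (vector [x, y]) = vector [a (d + 1 - k) + x * (y - 1), 0]"
  shows "retr \<circ> residual_layers f (d + 1) \<circ> lift = g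
       \<and> (\<forall>q :: real poly. degree q \<le> d \<longrightarrow>
            compositional_tensor {\<lambda>_. 1, id} lift retr (d + 1) (poly q))"
proof (intro conjI allI impI)
  \<comment> \<open>Stated for arbitrary coefficients and layers, as it is applied both to
    \<open>a\<close> with \<open>f\<close> and to \<open>coeff q\<close> with the layers built from
    \<open>q\<close>.\<close>
  have eval: "(retr \<circ> residual_layers h (d + 1) \<circ> lift) x = (\<Sum>i\<le>d. b i * x ^ i)"
    if "\<And>x y. h 1 (vector [x, y]) = vector [b d, 0]"
      and "\<And>k x y. 2 \<le> k \<Longrightarrow> k \<le> d + 1 \<Longrightarrow>
             h k (vector [x, y]) = vector [b (d + 1 - k) + x * (y - 1), 0]"
    for b :: "nat \<Rightarrow> real" and h :: "nat \<Rightarrow> real ^ 2 \<Rightarrow> real ^ 2" and x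
    using residual_layers_horner[of h b d d x, OF that] by (simp add: lift retr del: residual_layers.simps)
  show "retr \<circ> residual_layers f (d + 1) \<circ> lift = g"
    using eval[OF f_1 f_k] g by (intro ext) metis
  fix q :: "real poly"
  assume deg: "degree q \<le> d"
  define \<psi> :: "nat \<Rightarrow> real ^ 2 \<Rightarrow> real ^ 2" where
    "\<psi> k v = vector [coeff q (d + 1 - k) + (if k = 1 then 0 else 1) * (v $ 1 * (v $ 2 - 1)), 0]"
    for k v
  have span: "(\<lambda>v. \<psi> k v $ i) \<in> real_fun.span (tensor_products {\<lambda>_. 1, id})" for k i
  proof (cases "i = 1")
    case True
    then show ?thesis
      unfolding \<psi>_def vector_2 by (simp only: vector_2 bilinear_in_span_tensor_products)
  next
    case False
    then have "i = 2"
      using exhaust_2[of i] by simp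
    \<comment> \<open>The second component is the zero function, the case
      \<open>b = c = 0\<close>.\<close>
    then show ?thesis
      using bilinear_in_span_tensor_products[of 0 0] by (simp add: \<psi>_def)
  qed
  \<comment> \<open>If \<open>degree q < d\<close>, the sum is padded with vanishing coefficients,
    so the number of layers stays \<open>d + 1\<close>.\<close>
  have "(\<Sum>i\<le>d. coeff q i * x ^ i) = poly q x" for x
    unfolding poly_altdef using deg by (intro sum.mono_neutral_right) (auto simp: coeff_eq_0)
  then have "poly q = retr \<circ> residual_layers \<psi> (d + 1) \<circ> lift"
    using eval[of \<psi> "coeff q"] by (intro ext) (simp add: \<psi>_def)
  moreover have "linear lift"
    by (rule linearI) (simp_all add: lift vec_eq_iff forall_2)
  \<comment> \<open>\<open>retr\<close> is given on explicit pairs only; every vector is such a pair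
    by \<open>vector_2_eta\<close>.\<close>
  moreover have "retr v = v $ 1" for v
    using retr[of "v $ 1" "v $ 2"] by (simp add: vector_2_eta)
  then have "linear retr"
    by (intro linearI) simp_all
  ultimately show "compositional_tensor {\<lambda>_. 1, id} lift retr (d + 1) (poly q)"
    unfolding compositional_tensor_def using span by blast
qed

end
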